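(* Let $n\ge1$. For $k=1,\dots,n$, $$P_{q,\theta}\big(L_n^{(1)}=k\big)=\sum_{y=\lfloor n/(k+1)\rfloor}^{n-k}\theta^{n-y}\prod_{j=1}^{y}(1-\theta q^{j-1})\sum_{i=1}^{y+1}U_q^k(y+1,n-y,i).$$
   Context: Model: fix reals $0\le\theta\le1$ and $0<q<1$. $(X_j)_{j\ge1}$ is a sequence of $\{0,1\}$-valued random variables (1 = success, 0 = failure) with law $P_{q,\theta}$ such that, conditionally on $X_1,\dots,X_{j-1}$ containing exactly $i-1$ zeros, $X_j=0$ with probability $1-\theta q^{i-1}$ and $X_j=1$ with probability $\theta q^{i-1}$. Conventions: $0^0=1$, empty products are 1, empty sums are 0. $L_n^{(1)}$ is the length of the longest run of consecutive successes in $X_1,\dots,X_n$. For integers $r\ge1$ and $s,t$, $U_q^k(r,s,t)=\sum q^{x_2+2x_3+\dots+(r-1)x_r}$, the sum being over all integers $x_1,\dots,x_r$ with $0\le x_j\le k$, $x_1+\dots+x_r=s$, and $\delta_{x_1,k}+\dots+\delta_{x_r,k}=t$ (exactly $t$ of the $x_j$ equal $k$; $\delta$ is the Kronecker delta). *)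

theory Defs
  imports "HOL-Probability.Probability"
begin

text \<open>
  The law of the trials \<open>X 1, X 2, \<dots>\<close> (1 = success, 0 = failure); the value \<open>X 0\<close> is never used.
  The conditioning is on the full history \<open>X 1 = x 1, \<dots>, X (j - 1) = x (j - 1)\<close>, and the success
  probability of trial \<open>j\<close> depends on that history only through its number of zeros (which is
  \<open>i - 1\<close> in the usual indexing). Histories of probability zero impose no condition.
\<close>

locale geometric_trials = prob_space M
  for M :: "'a measure" and X :: "nat \<Rightarrow> 'a \<Rightarrow> nat" and q \<theta> :: real +
  assumes trial_measurable:
      "\<And>j. j \<ge> 1 \<Longrightarrow> X j \<in> M \<rightarrow>\<^sub>M count_space {0, 1}"
    and trial_failure:
      "\<And>j x. j \<ge> 1 \<Longrightarrow> \<P>(\<omega> in M. \<forall>l\<in>{1..<j}. X l \<omega> = x l) > 0 \<Longrightarrow>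
         \<P>(\<omega> in M. X j \<omega> = 0 \<bar> \<forall>l\<in>{1..<j}. X l \<omega> = x l)
           = 1 - \<theta> * q ^ card {l \<in> {1..<j}. x l = 0}"
    and trial_success:
      "\<And>j x. j \<ge> 1 \<Longrightarrow> \<P>(\<omega> in M. \<forall>l\<in>{1..<j}. X l \<omega> = x l) > 0 \<Longrightarrow>
         \<P>(\<omega> in M. X j \<omega> = 1 \<bar> \<forall>l\<in>{1..<j}. X l \<omega> = x l)
           = \<theta> * q ^ card {l \<in> {1..<j}. x l = 0}"

text \<open>
  Length of the longest block of consecutive ones among \<open>x 1, \<dots>, x n\<close>; the set always contains
  \<open>0\<close> (empty block), so the value is \<open>0\<close> if there are no ones.
\<close>

definition longest_success_run :: "nat \<Rightarrow> (nat \<Rightarrow> nat) \<Rightarrow> nat" where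
  "longest_success_run n x =
     Max {l. \<exists>i. i + l \<le> n \<and> (\<forall>j\<in>{i + 1..i + l}. x j = 1)}"

definition U :: "real \<Rightarrow> nat \<Rightarrow> nat \<Rightarrow> int \<Rightarrow> int \<Rightarrow> real" where
  "U q k r s t =
     (\<Sum>x \<in> {x \<in> {1..r} \<rightarrow>\<^sub>E {0..k}.
               int (\<Sum>j = 1..r. x j) = s \<and> int (card {j \<in> {1..r}. x j = k}) = t}.
        q ^ (\<Sum>j = 1..r. (j - 1) * x j))"

end

theory Submission
  imports Defs
begin

text \<open>
  Cut a word of successes and failures at its failures: a word with \<open>y\<close> failures becomes a sequence
  of \<open>y + 1\<close> gaps, the lengths of the (possibly empty) blocks of successes before, between and after
  the failures. This is a bijection between words and nonempty sequences of naturals, and both sides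
  of the theorem are sums over the same sequences.

  On the probabilistic side, a success in the gap with index \<open>j\<close> (counted from \<open>0\<close>) comes after
  exactly \<open>j\<close> failures and contributes \<open>\<theta> * q ^ j\<close>, while the failure ending that gap contributes
  \<open>1 - \<theta> * q ^ j\<close>. A word of length \<open>n\<close> with \<open>y\<close> failures and gaps \<open>g\<close> therefore has probability
  \<open>\<theta> ^ (n - y) * (\<Prod>j<y. 1 - \<theta> * q ^ j) * q ^ (\<Sum>j\<le>y. j * g j)\<close>; see
  \<open>prob_outcome\<close> and \<open>word_weight_gaps\<close>.

  The longest run of successes is the largest gap (\<open>longest_success_run_eq_iff\<close>), so it equals \<open>k\<close>
  when all gaps are at most \<open>k\<close> and some gap is \<open>k\<close>. With \<open>y\<close> fixed, summing
  \<open>q ^ (\<Sum>j\<le>y. j * g j)\<close> over the gap sequences of total \<open>n - y\<close> with this property, sorted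
  by the number \<open>i \<ge> 1\<close> of gaps equal to \<open>k\<close>, is the sum of the \<open>U\<close> terms
  (\<open>sum_U_eq_sum_lists\<close>).

  Finally \<open>y\<close> is confined to the stated range: some gap is \<open>k\<close>, so \<open>k \<le> n - y\<close>; and \<open>y + 1\<close> gaps of
  size at most \<open>k\<close> give \<open>n - y \<le> (y + 1) * k\<close>, that is \<open>n < (k + 1) * (y + 1)\<close>.
\<close>

section \<open>Words and their gaps\<close>

text \<open>In a word, \<open>True\<close> is a success and \<open>False\<close> a failure.\<close>

fun gaps :: "bool list \<Rightarrow> nat list" where
  "gaps [] = [0]"
| "gaps (False # w) = 0 # gaps w"
| "gaps (True # w) = Suc (hd (gaps w)) # tl (gaps w)"

lemma gaps_not_Nil [simp]: "gaps w \<noteq> []"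
  by (induction w rule: gaps.induct) auto

lemma gaps_eq_Cons: obtains g gs where "gaps w = g # gs"
  by (metis gaps_not_Nil neq_Nil_conv)

lemma length_gaps: "length (gaps w) = Suc (count_list w False)"
  by (induction w rule: gaps.induct) auto

lemma sum_list_gaps: "sum_list (gaps w) = count_list w True"
proof (induction w rule: gaps.induct)
  case (3 w)
  then show ?case by (cases "gaps w" rule: list.exhaust) auto
qed auto

lemma count_list_bool: "count_list w True + count_list w False = length w"
  by (induction w) auto

lemma inj_gaps: "inj gaps"
proof (rule injI)
  fix v w show "gaps v = gaps w \<Longrightarrow> v = w"
  proof (induction v arbitrary: w rule: gaps.induct)
    case 1
    then show ?case by (cases w rule: gaps.cases) (auto simp: gaps_not_Nil[symmetric] simp del: gaps_not_Nil)
  next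
    case (2 v)
    then show ?case by (cases w rule: gaps.cases) auto
  next
    case (3 v)
    show ?case
    proof (cases w rule: gaps.cases)
      case (3 w')
      then have "gaps v = gaps w'"
        using "3.prems" by (intro list.expand) simp_all
      then show ?thesis using "3.IH" 3 by simp
    qed (use "3.prems" in simp_all)
  qed
qed

text \<open>
  A preimage of \<open>g # gs\<close> is built from right to left: a failure (unless \<open>gs\<close> is empty) puts a gap \<open>0\<close>
  in front of \<open>gs\<close>, and \<open>g\<close> successes then raise that gap to \<open>g\<close>.
\<close>

lemma range_gaps: "range gaps = {gs. gs \<noteq> []}"
proof -
  have "\<exists>w. gaps w = gs" if "gs \<noteq> []" for gs
    using that
  proof (induction gs)
    case (Cons g gs)
    obtain w where w: "gaps w = 0 # gs"
    proof (cases "gs = []")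
      case True
      then show ?thesis using that[of "[]"] by simp
    next
      case False
      then obtain v where "gaps v = gs" using Cons.IH by blast
      then show ?thesis using that[of "False # v"] by simp
    qed
    have "gaps (replicate g True @ w) = g # gs"
      by (induction g) (auto simp: w)
    then show ?case by blast
  qed simp
  then show ?thesis by auto
qed

lemma prefix_run_iff:
  "l \<le> length w \<and> (\<forall>j<l. w ! j) \<longleftrightarrow> l \<le> hd (gaps w)"
proof (induction w arbitrary: l rule: gaps.induct)
  case (2 w)
  then show ?case by (cases l) auto
next
  case (3 w)
  then show ?case by (cases l) (auto simp: All_less_Suc2)
qed auto

text \<open>
  A block of \<open>l\<close> successes in \<open>b # w\<close> either starts at the first letter, where the first gap decides
  (\<open>prefix_run_iff\<close>), or lies entirely in \<open>w\<close>.
\<close>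

lemma run_iff:
  "(\<exists>i. i + l \<le> length w \<and> (\<forall>j<l. w ! (i + j))) \<longleftrightarrow> (\<exists>g\<in>set (gaps w). l \<le> g)"
proof (induction w)
  case (Cons b w)
  have "(\<exists>i. i + l \<le> length (b # w) \<and> (\<forall>j<l. (b # w) ! (i + j))) \<longleftrightarrow>
        (l \<le> length (b # w) \<and> (\<forall>j<l. (b # w) ! j))
          \<or> (\<exists>i. i + l \<le> length w \<and> (\<forall>j<l. w ! (i + j)))"
    (is "(\<exists>i. ?P i) \<longleftrightarrow> _ \<or> (\<exists>i. ?Q i)")
  proof -
    have split: "(\<exists>i. P i) \<longleftrightarrow> P 0 \<or> (\<exists>i. P (Suc i))" for P :: "nat \<Rightarrow> bool"
      by (metis not0_implies_Suc)
    show ?thesis by (subst split) simp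
  qed
  also have "\<dots> \<longleftrightarrow> l \<le> hd (gaps (b # w)) \<or> (\<exists>g\<in>set (gaps w). l \<le> g)"
    by (simp only: prefix_run_iff Cons.IH)
  also have "\<dots> \<longleftrightarrow> (\<exists>g\<in>set (gaps (b # w)). l \<le> g)"
    by (cases "gaps w"; cases b) auto
  finally show ?case .
qed auto

lemma longest_success_run_eq_iff:
  assumes "length w = n" and "\<And>j. j < n \<Longrightarrow> w ! j \<longleftrightarrow> x (Suc j) = 1"
  shows "longest_success_run n x = k \<longleftrightarrow> k \<in> set (gaps w) \<and> set (gaps w) \<subseteq> {..k}"
proof -
  have block: "(\<forall>j\<in>{i + 1..i + l}. x j = 1) \<longleftrightarrow> (\<forall>j<l. w ! (i + j))" if "i + l \<le> n" for i l
  proof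
    assume *: "\<forall>j\<in>{i + 1..i + l}. x j = 1"
    show "\<forall>j<l. w ! (i + j)" using that * assms(2) by simp
  next
    assume *: "\<forall>j<l. w ! (i + j)"
    show "\<forall>j\<in>{i + 1..i + l}. x j = 1"
    proof
      fix j assume j: "j \<in> {i + 1..i + l}"
      then have "j - Suc i < l" by auto
      then have "w ! (i + (j - Suc i))" using * by blast
      moreover have "i + (j - Suc i) = j - 1" using j by auto
      ultimately have "w ! (j - 1)" by simp
      then show "x j = 1" using assms(2)[of "j - 1"] j that by auto
    qed
  qed
  have "{l. \<exists>i. i + l \<le> n \<and> (\<forall>j\<in>{i + 1..i + l}. x j = 1)} = {l. \<exists>g\<in>set (gaps w). l \<le> g}"
    unfolding run_iff[symmetric] using assms(1) block by auto
  also have "\<dots> = (\<Union>g\<in>set (gaps w). {..g})" by auto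
  finally have "longest_success_run n x = Max (\<Union>g\<in>set (gaps w). {..g})"
    unfolding longest_success_run_def by simp
  also have "\<dots> = Max (set (gaps w))"
  proof (rule Max_eqI)
    show "Max (set (gaps w)) \<in> (\<Union>g\<in>set (gaps w). {..g})"
      by (intro UN_I[of "Max (set (gaps w))"] Max_in) simp_all
  next
    fix l assume "l \<in> (\<Union>g\<in>set (gaps w). {..g})"
    then show "l \<le> Max (set (gaps w))"
      by (auto intro: order.trans Max_ge)
  qed simp
  finally have Max: "longest_success_run n x = Max (set (gaps w))" .
  show ?thesis unfolding Max by (subst Max_eq_iff) auto
qed

section \<open>The probability of a word\<close>

text \<open>
  The probability of continuing with the given word once \<open>i\<close> failures have occurred. The offset \<open>i\<close>
  lets the recursion consume the word from the left, as \<^const>\<open>gaps\<close> does.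
\<close>

fun word_weight :: "real \<Rightarrow> real \<Rightarrow> nat \<Rightarrow> bool list \<Rightarrow> real" where
  "word_weight q \<theta> i [] = 1"
| "word_weight q \<theta> i (False # w) = (1 - \<theta> * q ^ i) * word_weight q \<theta> (Suc i) w"
| "word_weight q \<theta> i (True # w) = \<theta> * q ^ i * word_weight q \<theta> i w"

text \<open>
  The law of the trials extends a word at its right end, while \<^const>\<open>word_weight\<close> and
  \<^const>\<open>gaps\<close> recurse from the left; this lemma reconciles the two directions.
\<close>

lemma word_weight_snoc:
  "word_weight q \<theta> i (w @ [b]) = word_weight q \<theta> i w *
     (if b then \<theta> * q ^ (i + count_list w False) else 1 - \<theta> * q ^ (i + count_list w False))"
  by (induction q \<theta> i w rule: word_weight.induct) (cases b; simp)+

text \<open>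
  A leading failure moves every later gap one index up, which \<open>i\<close> becoming \<open>Suc i\<close> accounts for; a
  leading success raises the first gap by one and so adds \<open>i\<close> to the exponent of \<open>q\<close>.
\<close>

lemma word_weight_gaps:
  "word_weight q \<theta> i w =
     \<theta> ^ count_list w True * (\<Prod>j<count_list w False. 1 - \<theta> * q ^ (i + j))
       * q ^ (\<Sum>j<length (gaps w). (i + j) * gaps w ! j)"
proof (induction q \<theta> i w rule: word_weight.induct)
  case (2 q \<theta> i w)
  have "(\<Prod>j<Suc (count_list w False). 1 - \<theta> * q ^ (i + j))
          = (1 - \<theta> * q ^ i) * (\<Prod>j<count_list w False. 1 - \<theta> * q ^ (Suc i + j))"
    by (subst prod.lessThan_Suc_shift) simp
  moreover have "(\<Sum>j<length (gaps (False # w)). (i + j) * gaps (False # w) ! j)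
          = (\<Sum>j<length (gaps w). (Suc i + j) * gaps w ! j)"
    by (simp only: gaps.simps list.size add_Suc_right add_0_right sum.lessThan_Suc_shift) simp
  ultimately show ?case using 2 by simp
next
  case (3 q \<theta> i w)
  obtain g gs where g: "gaps w = g # gs" by (rule gaps_eq_Cons)
  have "(\<Sum>j<length (gaps (True # w)). (i + j) * gaps (True # w) ! j)
          = i + (\<Sum>j<length (gaps w). (i + j) * gaps w ! j)"
    by (simp add: g sum.lessThan_Suc_shift del: sum.lessThan_Suc)
  then show ?case using 3 by (simp add: power_add)
qed simp

context geometric_trials
begin

definition outcome :: "nat \<Rightarrow> 'a \<Rightarrow> bool list" where
  "outcome n \<omega> = map (\<lambda>j. X j \<omega> = 1) [1..<Suc n]"

lemma length_outcome [simp]: "length (outcome n \<omega>) = n"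
  by (simp add: outcome_def)

lemma outcome_Suc: "outcome (Suc n) \<omega> = outcome n \<omega> @ [X (Suc n) \<omega> = 1]"
  by (simp add: outcome_def)

lemma nth_outcome: "j < n \<Longrightarrow> outcome n \<omega> ! j \<longleftrightarrow> X (Suc j) \<omega> = 1"
  by (simp add: outcome_def del: upt_Suc)

lemma trial_range: "j \<ge> 1 \<Longrightarrow> \<omega> \<in> space M \<Longrightarrow> X j \<omega> \<in> {0, 1}"
  using measurable_space[OF trial_measurable] by auto

lemma trial_sets: "j \<ge> 1 \<Longrightarrow> {\<omega> \<in> space M. X j \<omega> = 1} \<in> events"
  using measurable_sets[OF trial_measurable, of j "{1}"]
  by (simp add: vimage_def Int_def conj_commute)

lemma outcome_sets: "{\<omega> \<in> space M. outcome n \<omega> = w} \<in> events"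
proof (induction n arbitrary: w)
  case 0
  then show ?case by (cases "w = []") (auto simp: outcome_def)
next
  case (Suc n)
  show ?case
  proof (cases w rule: rev_exhaust)
    case Nil
    then show ?thesis by (simp add: outcome_Suc)
  next
    case (snoc v b)
    have "{\<omega> \<in> space M. outcome (Suc n) \<omega> = w} =
      (if b then {\<omega> \<in> space M. outcome n \<omega> = v} \<inter> {\<omega> \<in> space M. X (Suc n) \<omega> = 1}
       else {\<omega> \<in> space M. outcome n \<omega> = v} - {\<omega> \<in> space M. X (Suc n) \<omega> = 1})"
      by (auto simp: outcome_Suc snoc)
    then show ?thesis using Suc trial_sets[of "Suc n"] by auto
  qed
qed

text \<open>
  The law of the trials conditions on numerical histories indexed from \<open>1\<close>; the next two lemmas
  translate between these and words, first for the events and then for the number of failures.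
\<close>

lemma outcome_eq_iff:
  assumes "\<omega> \<in> space M" and "length w = n"
  shows "outcome n \<omega> = w \<longleftrightarrow> (\<forall>l\<in>{1..<Suc n}. X l \<omega> = of_bool (w ! (l - 1)))"
proof -
  have "outcome n \<omega> = w \<longleftrightarrow> (\<forall>j<n. X (Suc j) \<omega> = 1 \<longleftrightarrow> w ! j)"
    using assms(2) by (auto simp: list_eq_iff_nth_eq nth_outcome)
  also have "\<dots> \<longleftrightarrow> (\<forall>j<n. X (Suc j) \<omega> = of_bool (w ! j))"
  proof -
    have "(X (Suc j) \<omega> = 1 \<longleftrightarrow> w ! j) \<longleftrightarrow> X (Suc j) \<omega> = of_bool (w ! j)" for j
      using trial_range[OF _ assms(1), of "Suc j"] by (cases "w ! j") auto
    then show ?thesis by simp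
  qed
  also have "\<dots> \<longleftrightarrow> (\<forall>l\<in>{1..<Suc n}. X l \<omega> = of_bool (w ! (l - 1)))"
    unfolding atLeastLessThanSuc_atLeastAtMost image_Suc_lessThan[symmetric] by auto
  finally show ?thesis .
qed

lemma count_list_False_eq_card:
  "count_list w False = card {l \<in> {1..<Suc (length w)}. (of_bool (w ! (l - 1)) :: nat) = 0}"
proof -
  have "count_list w False = card {i. i < length w \<and> \<not> w ! i}"
    by (simp add: count_list_eq_length_filter length_filter_conv_card)
  also have "\<dots> = card (Suc ` {i. i < length w \<and> \<not> w ! i})"
    by (simp add: card_image)
  also have "Suc ` {i. i < length w \<and> \<not> w ! i} =
      {l \<in> {1..<Suc (length w)}. (of_bool (w ! (l - 1)) :: nat) = 0}"
  proof (intro equalityI subsetI)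
    fix l assume "l \<in> {l \<in> {1..<Suc (length w)}. (of_bool (w ! (l - 1)) :: nat) = 0}"
    then show "l \<in> Suc ` {i. i < length w \<and> \<not> w ! i}"
      by (intro image_eqI[of _ _ "l - 1"]) auto
  qed auto
  finally show ?thesis .
qed

text \<open>
  The chain rule, one trial at a time. Where the history has probability zero, its conditional
  probabilities are not prescribed, but then both sides vanish.
\<close>

lemma prob_outcome:
  "length w = n \<Longrightarrow> \<P>(\<omega> in M. outcome n \<omega> = w) = word_weight q \<theta> 0 w"
proof (induction n arbitrary: w)
  case 0
  then show ?case by (simp add: outcome_def prob_space)
next
  case (Suc n)
  then obtain v b where w: "w = v @ [b]" and v: "length v = n"
    by (cases w rule: rev_exhaust) auto
  let ?x = "\<lambda>l. of_bool (v ! (l - 1)) :: nat"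
  let ?c = "card {l \<in> {1..<Suc n}. ?x l = 0}"
  let ?H = "\<P>(\<omega> in M. \<forall>l\<in>{1..<Suc n}. X l \<omega> = ?x l)"
  have H_eq: "{\<omega> \<in> space M. \<forall>l\<in>{1..<Suc n}. X l \<omega> = ?x l} = {\<omega> \<in> space M. outcome n \<omega> = v}"
    using outcome_eq_iff[OF _ v] by blast
  have H: "?H = word_weight q \<theta> 0 v"
    unfolding H_eq using Suc.IH[OF v] .
  have ev: "{\<omega> \<in> space M. outcome (Suc n) \<omega> = w} =
     {\<omega> \<in> space M. X (Suc n) \<omega> = of_bool b \<and> (\<forall>l\<in>{1..<Suc n}. X l \<omega> = ?x l)}"
  proof (intro Collect_cong conj_cong refl)
    fix \<omega> assume \<omega>: "\<omega> \<in> space M"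
    have "X (Suc n) \<omega> = of_bool b \<longleftrightarrow> (X (Suc n) \<omega> = 1) = b"
      using trial_range[OF _ \<omega>, of "Suc n"] by (cases b) auto
    then show "outcome (Suc n) \<omega> = w \<longleftrightarrow>
        X (Suc n) \<omega> = of_bool b \<and> (\<forall>l\<in>{1..<Suc n}. X l \<omega> = ?x l)"
      unfolding outcome_eq_iff[OF \<omega> v, symmetric] by (auto simp: outcome_Suc w)
  qed
  have c: "?c = count_list v False"
    using count_list_False_eq_card[of v] v by simp
  show ?case
  proof (cases "?H = 0")
    case True
    have "prob {\<omega> \<in> space M. outcome (Suc n) \<omega> = w} \<le> prob {\<omega> \<in> space M. outcome n \<omega> = v}"
      by (rule finite_measure_mono) (auto simp: outcome_Suc w outcome_sets)
    then have "prob {\<omega> \<in> space M. outcome (Suc n) \<omega> = w} = 0"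
      using True H_eq by (simp add: measure_le_0_iff)
    then show ?thesis using True H by (simp add: w word_weight_snoc)
  next
    case False
    then have pos: "?H > 0" by (simp add: zero_less_measure_iff)
    have "\<P>(\<omega> in M. X (Suc n) \<omega> = of_bool b \<bar> \<forall>l\<in>{1..<Suc n}. X l \<omega> = ?x l)
        = (if b then \<theta> * q ^ ?c else 1 - \<theta> * q ^ ?c)"
      using trial_success[OF _ pos] trial_failure[OF _ pos] by (cases b) simp_all
    then have "\<P>(\<omega> in M. outcome (Suc n) \<omega> = w) = ?H * (if b then \<theta> * q ^ ?c else 1 - \<theta> * q ^ ?c)"
      using False unfolding cond_prob_def ev by (simp add: field_simps del: set_upt)
    then show ?thesis
      unfolding H c w word_weight_snoc by simp
  qed
qed

lemma prob_outcome_in: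
  assumes "\<And>w. w \<in> S \<Longrightarrow> length w = n"
  shows "\<P>(\<omega> in M. outcome n \<omega> \<in> S) = (\<Sum>w\<in>S. word_weight q \<theta> 0 w)"
proof -
  have fin: "finite S"
    by (rule finite_subset[OF _ finite_lists_length_eq[of UNIV n]]) (use assms in auto)
  have "{\<omega> \<in> space M. outcome n \<omega> \<in> S} = (\<Union>w\<in>S. {\<omega> \<in> space M. outcome n \<omega> = w})"
    by auto
  then have "\<P>(\<omega> in M. outcome n \<omega> \<in> S) = (\<Sum>w\<in>S. \<P>(\<omega> in M. outcome n \<omega> = w))"
    using fin by (auto simp: disjoint_family_on_def outcome_sets intro!: finite_measure_finite_Union)
  also have "\<dots> = (\<Sum>w\<in>S. word_weight q \<theta> 0 w)"
    by (rule sum.cong) (use assms prob_outcome in auto)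
  finally show ?thesis .
qed

end

section \<open>Summing U over the number of maximal entries\<close>

text \<open>
  The index \<open>i\<close> in \<open>U\<close> is the number of entries equal to \<open>k\<close>. Among \<open>r\<close> entries it is at most \<open>r\<close>, so
  summing from \<open>1\<close> to \<open>r\<close> says only that \<open>k\<close> occurs. The remaining step turns functions on
  \<open>{1..r}\<close> into lists.
\<close>

lemma sum_U_eq_sum_lists:
  "(\<Sum>i = 1..r. U q k r (int s) (int i)) =
     (\<Sum>gs | length gs = r \<and> sum_list gs = s \<and> k \<in> set gs \<and> set gs \<subseteq> {..k}.
        q ^ (\<Sum>j<r. j * gs ! j))"
proof -
  define S where "S = {x \<in> {1..r} \<rightarrow>\<^sub>E {0..k}. (\<Sum>j = 1..r. x j) = s \<and> (\<exists>j\<in>{1..r}. x j = k)}"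
  let ?c = "\<lambda>x. card {j \<in> {1..r}. x j = k}"
  let ?f = "\<lambda>x. q ^ (\<Sum>j = 1..r. (j - 1) * x j)"
  have fin: "finite S"
    unfolding S_def by (rule finite_subset[OF _ finite_PiE[of "{1..r}" "\<lambda>_. {0..k}"]]) auto
  have c_pos: "?c x \<ge> 1 \<longleftrightarrow> (\<exists>j\<in>{1..r}. x j = k)" for x
    by (auto simp: Suc_le_eq card_gt_0_iff)
  have c_le: "?c x \<le> r" for x
  proof -
    have "?c x \<le> card {1..r}" by (rule card_mono) auto
    then show ?thesis by simp
  qed
  have "(\<Sum>i = 1..r. U q k r (int s) (int i)) = (\<Sum>i = 1..r. \<Sum>x | x \<in> S \<and> ?c x = i. ?f x)"
  proof (rule sum.cong)
    fix i assume "i \<in> {1..r}"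
    then have "{x \<in> {1..r} \<rightarrow>\<^sub>E {0..k}. int (\<Sum>j = 1..r. x j) = int s \<and> int (?c x) = int i}
        = {x \<in> S. ?c x = i}"
      unfolding S_def of_nat_eq_iff using c_pos by fastforce
    then show "U q k r (int s) (int i) = (\<Sum>x | x \<in> S \<and> ?c x = i. ?f x)"
      unfolding U_def by simp
  qed simp
  also have "\<dots> = (\<Sum>x\<in>S. ?f x)"
  proof (rule sum.group[OF fin])
    show "?c ` S \<subseteq> {1..r}" using c_le c_pos unfolding S_def by fastforce
  qed simp
  also have "\<dots> = (\<Sum>gs | length gs = r \<and> sum_list gs = s \<and> k \<in> set gs \<and> set gs \<subseteq> {..k}.
        q ^ (\<Sum>j<r. j * gs ! j))"
  proof -
    have sl: "sum_list gs = (\<Sum>j<length gs. gs ! j)" for gs :: "nat list"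
      by (simp add: sum_list_sum_nth atLeast0LessThan)
    show ?thesis
    proof (rule sum.reindex_bij_witness[where
          i = "\<lambda>gs. restrict (\<lambda>j. gs ! (j - 1)) {1..r}" and j = "\<lambda>x. map x [1..<Suc r]"])
      fix x assume x: "x \<in> S"
      show "restrict (\<lambda>j. map x [1..<Suc r] ! (j - 1)) {1..r} = x"
        using x by (auto simp: S_def fun_eq_iff PiE_def extensional_def restrict_def simp del: upt_Suc)
      show "map x [1..<Suc r] \<in> {gs. length gs = r \<and> sum_list gs = s \<and> k \<in> set gs \<and> set gs \<subseteq> {..k}}"
        using x unfolding S_def sl by (auto simp: sum.atLeast1_atMost_eq PiE_def simp del: upt_Suc)
      show "q ^ (\<Sum>j<r. j * map x [1..<Suc r] ! j) = ?f x"
        by (simp add: sum.atLeast1_atMost_eq del: upt_Suc)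
    next
      fix gs assume gs: "gs \<in> {gs. length gs = r \<and> sum_list gs = s \<and> k \<in> set gs \<and> set gs \<subseteq> {..k}}"
      let ?x = "restrict (\<lambda>j. gs ! (j - 1)) {1..r}"
      show "map ?x [1..<Suc r] = gs"
        using gs by (auto simp: list_eq_iff_nth_eq simp del: upt_Suc)
      obtain j where "j < r" "gs ! j = k" using gs by (auto simp: in_set_conv_nth)
      then have "\<exists>j\<in>{1..r}. ?x j = k" by (intro bexI[of _ "Suc j"]) auto
      moreover have "?x \<in> {1..r} \<rightarrow>\<^sub>E {0..k}"
      proof (rule PiE_I)
        fix j assume j: "j \<in> {1..r}"
        then have "gs ! (j - 1) \<in> set gs" using gs by (intro nth_mem) auto
        then show "?x j \<in> {0..k}" using gs j by auto
      qed auto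
      ultimately show "?x \<in> S" using gs by (auto simp: S_def sl sum.atLeast1_atMost_eq)
    qed
  qed
  finally show ?thesis .
qed

section \<open>The distribution of the longest run\<close>

theorem theorem6p1:
  fixes M :: "'a measure" and X :: "nat \<Rightarrow> 'a \<Rightarrow> nat"
    and q \<theta> :: real and n k :: nat
  assumes "0 \<le> \<theta>" and "\<theta> \<le> 1" and "0 < q" and "q < 1"
    and "geometric_trials M X q \<theta>"
    and "n \<ge> 1" and "1 \<le> k" and "k \<le> n"
  shows "\<P>(\<omega> in M. longest_success_run n (\<lambda>j. X j \<omega>) = k) =
    (\<Sum>y = n div (k + 1)..n - k.
       \<theta> ^ (n - y) * (\<Prod>j = 1..y. 1 - \<theta> * q ^ (j - 1))
         * (\<Sum>i = 1..y + 1. U q k (y + 1) (int (n - y)) (int i)))"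
proof -
  interpret geometric_trials M X q \<theta> by fact
  define S where "S = {w. length w = n \<and> k \<in> set (gaps w) \<and> set (gaps w) \<subseteq> {..k}}"
  have fin: "finite S"
    by (rule finite_subset[OF _ finite_lists_length_eq[of UNIV n]]) (auto simp: S_def)
  have range: "count_list w False \<in> {n div (k + 1)..n - k}" if "w \<in> S" for w
  proof -
    let ?y = "count_list w False"
    have n: "sum_list (gaps w) + ?y = n"
      using that count_list_bool[of w] by (simp add: S_def sum_list_gaps)
    have "k \<le> sum_list (gaps w)"
      using that by (intro member_le_sum_list) (auto simp: S_def)
    then have "?y \<le> n - k" using n by simp
    moreover have "n < (k + 1) * Suc ?y"
    proof -
      have "sum_list (gaps w) \<le> length (gaps w) * k"
        using that sum_list_mono[of "gaps w" id "\<lambda>_. k"]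
        by (auto simp: S_def sum_list_triv)
      then show ?thesis using n by (simp add: length_gaps algebra_simps)
    qed
    then have "n div (k + 1) < Suc ?y"
      by (simp add: div_less_iff_less_mult mult.commute)
    ultimately show ?thesis by simp
  qed
  have "\<P>(\<omega> in M. longest_success_run n (\<lambda>j. X j \<omega>) = k) = \<P>(\<omega> in M. outcome n \<omega> \<in> S)"
    using longest_success_run_eq_iff[OF length_outcome nth_outcome] by (simp add: S_def)
  also have "\<dots> = (\<Sum>w\<in>S. word_weight q \<theta> 0 w)"
    by (rule prob_outcome_in) (simp add: S_def)
  also have "\<dots> = (\<Sum>y = n div (k + 1)..n - k. \<Sum>w | w \<in> S \<and> count_list w False = y. word_weight q \<theta> 0 w)"
    by (rule sum.group[symmetric]) (use fin range in auto)
  also have "\<dots> = (\<Sum>y = n div (k + 1)..n - k.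
       \<theta> ^ (n - y) * (\<Prod>j = 1..y. 1 - \<theta> * q ^ (j - 1))
         * (\<Sum>i = 1..y + 1. U q k (y + 1) (int (n - y)) (int i)))"
  proof (rule sum.cong)
    fix y assume y: "y \<in> {n div (k + 1)..n - k}"
    let ?W = "{w. w \<in> S \<and> count_list w False = y}"
    let ?G = "{gs. length gs = y + 1 \<and> sum_list gs = n - y \<and> k \<in> set gs \<and> set gs \<subseteq> {..k}}"
    let ?C = "\<theta> ^ (n - y) * (\<Prod>j = 1..y. 1 - \<theta> * q ^ (j - 1))"
    have "gaps ` ?W = ?G"
    proof (intro equalityI subsetI)
      fix gs assume "gs \<in> gaps ` ?W"
      then show "gs \<in> ?G"
        using count_list_bool by (auto simp: S_def length_gaps sum_list_gaps)
          (metis add_diff_cancel_right')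
    next
      fix gs assume gs: "gs \<in> ?G"
      then have "gs \<in> range gaps" unfolding range_gaps by auto
      then obtain w where w: "gs = gaps w" by auto
      moreover have "count_list w False = y" "length w = n"
        using gs y count_list_bool[of w] by (auto simp: w length_gaps sum_list_gaps)
      ultimately show "gs \<in> gaps ` ?W" using gs by (auto simp: S_def)
    qed
    then have bij: "bij_betw gaps ?W ?G"
      using inj_gaps by (auto simp: bij_betw_def intro: inj_on_subset)
    have "(\<Sum>w\<in>?W. word_weight q \<theta> 0 w) = (\<Sum>w\<in>?W. ?C * q ^ (\<Sum>j<y + 1. j * gaps w ! j))"
    proof (rule sum.cong)
      fix w assume w: "w \<in> ?W"
      then have "count_list w True = n - y" using count_list_bool[of w] by (auto simp: S_def)
      then show "word_weight q \<theta> 0 w = ?C * q ^ (\<Sum>j<y + 1. j * gaps w ! j)"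
        using w by (simp add: word_weight_gaps length_gaps prod.atLeast1_atMost_eq)
    qed simp
    also have "\<dots> = (\<Sum>gs\<in>?G. ?C * q ^ (\<Sum>j<y + 1. j * gs ! j))"
      by (rule sum.reindex_bij_betw[OF bij])
    also have "\<dots> = ?C * (\<Sum>i = 1..y + 1. U q k (y + 1) (int (n - y)) (int i))"
      by (simp only: sum_U_eq_sum_lists sum_distrib_left)
    finally show "(\<Sum>w\<in>?W. word_weight q \<theta> 0 w) =
        ?C * (\<Sum>i = 1..y + 1. U q k (y + 1) (int (n - y)) (int i))" .
  qed simp
  finally show ?thesis .
qed

end
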